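(* Let $G$ be a non-cyclic finite simple group of order $n$. Then every non-trivial representation of $G$ has dimension at least $\sqrt{\log n}/2$.
   Context: Representations are finite-dimensional complex representations. A representation is non-trivial if at least one group element acts as something other than the identity map. Here $\log$ is the natural logarithm, and $\sqrt{\log n}/2$ means $\frac12\sqrt{\log n}$. *)

theory Defs
  imports Complex_Main "HOL-Algebra.SimpleGroups" "HOL-Algebra.Elementary_Groups"
begin

text \<open>The underlying vector space is the whole type \<open>'v\<close> with the scalar multiplication \<open>scale\<close>.\<close>

definition GL :: "(complex \<Rightarrow> 'v \<Rightarrow> 'v) \<Rightarrow> ('v::ab_group_add \<Rightarrow> 'v) monoid" where
  "GL scale = \<lparr>carrier = {f. Vector_Spaces.linear scale scale f \<and> bij f}, monoid.mult = (\<circ>), one = id\<rparr>"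

lemma group_GL:
  assumes "vector_space scale"
  shows "group (GL scale)"
proof -
  interpret vector_space scale by fact
  interpret vector_space_pair scale scale ..
  show ?thesis
  proof (rule groupI)
    fix f assume "f \<in> carrier (GL scale)"
    then have f: "Vector_Spaces.linear scale scale f" "bij f"
      by (auto simp: GL_def)
    interpret f: Vector_Spaces.linear scale scale f by fact
    have g: "f (inv_into UNIV f z) = z" for z
      using f(2) by (simp add: bij_is_surj surj_f_inv_f)
    have "Vector_Spaces.linear scale scale (inv_into UNIV f)"
    proof (unfold_locales)
      fix x y
      show "inv_into UNIV f (x + y) = inv_into UNIV f x + inv_into UNIV f y"
        using f(2) by (intro inv_f_eq) (simp_all add: bij_is_inj f.add g)
    next
      fix c x
      show "inv_into UNIV f (scale c x) = scale c (inv_into UNIV f x)"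
        using f(2) by (intro inv_f_eq) (simp_all add: bij_is_inj f.scale g)
    qed
    with f show "\<exists>g\<in>carrier (GL scale). g \<otimes>\<^bsub>GL scale\<^esub> f = \<one>\<^bsub>GL scale\<^esub>"
      by (intro bexI[of _ "inv_into UNIV f"]) (auto simp: GL_def bij_imp_bij_inv bij_is_inj)
  qed (auto simp: GL_def Vector_Spaces.linear_compose linear_id bij_comp comp_assoc)
qed

definition fd_representation ::
  "('g, 'm) monoid_scheme \<Rightarrow> (complex \<Rightarrow> 'v::ab_group_add \<Rightarrow> 'v) \<Rightarrow> ('g \<Rightarrow> 'v \<Rightarrow> 'v) \<Rightarrow> bool" where
  "fd_representation G scale \<rho> \<longleftrightarrow>
     (\<exists>B. finite_dimensional_vector_space scale B) \<and> \<rho> \<in> hom G (GL scale)"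

definition nontrivial_representation ::
  "('g, 'm) monoid_scheme \<Rightarrow> ('g \<Rightarrow> 'v \<Rightarrow> 'v) \<Rightarrow> bool" where
  "nontrivial_representation G \<rho> \<longleftrightarrow> (\<exists>g\<in>carrier G. \<rho> g \<noteq> id)"

end

theory Submission
  imports Defs
begin

text \<open>
  A non-trivial representation of dimension \<open>d\<close> is faithful; fix a \<open>G\<close>-invariant norm on it.  If some
  \<open>g \<noteq> 1\<close> had operator distance less than \<open>1/2\<close> from the identity, a \<open>g\<close> at minimal distance would
  commute with all its conjugates \<open>h\<close>, since the commutator of \<open>g\<close> and \<open>h\<close> is at distance at most
  \<open>2 |g - 1| |h - 1| < |g - 1|\<close>.  The centralizer of the conjugacy class of \<open>g\<close> is normal, so \<open>g\<close> would
  be central and \<open>G\<close> cyclic.  Hence distinct elements of \<open>G\<close> are \<open>1/2\<close>-separated points of the unit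
  ball of a normed space of real dimension \<open>2 d\<^sup>2\<close>, whence \<open>n \<le> 6 ^ (2 d\<^sup>2) \<le> exp (4 d\<^sup>2)\<close>.
\<close>

section \<open>Separated points in a finite-dimensional normed space\<close>

lemma sum_power_le_geometric:
  fixes r :: real
  assumes "0 < r" "r < 1"
  shows "(\<Sum>k<K. r ^ k) \<le> 1 / (1 - r)"
proof -
  have "(\<Sum>k<K. r ^ k) = (1 - r ^ K) / (1 - r)"
    using assms by (simp add: sum_gp_strict)
  also have "\<dots> \<le> 1 / (1 - r)"
    using assms by (intro divide_right_mono) auto
  finally show ?thesis .
qed

text \<open>At the first index where the digits differ, some coordinate has a gap of at least
  \<open>\<delta>\<close>, and all later digits together can cancel at most
  \<open>2 * (r + r^2 + ...) = 2 * r / (1 - r)\<close> of it. A common prefix only scales what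
  remains by a power of \<open>r\<close>, which is at least \<open>r ^ K\<close>.\<close>

lemma digit_expansions_separated:
  fixes y :: "'s \<Rightarrow> 'j \<Rightarrow> complex" and r \<delta> :: real
  assumes r: "0 < r" "r < 1" and \<delta>: "2 * r / (1 - r) \<le> \<delta>"
    and bounded: "\<And>g j. g \<in> S \<Longrightarrow> j \<in> J \<Longrightarrow> cmod (y g j) \<le> 1"
    and sep: "\<And>g h. g \<in> S \<Longrightarrow> h \<in> S \<Longrightarrow> g \<noteq> h \<Longrightarrow> \<exists>j\<in>J. \<delta> \<le> cmod (y g j - y h j)"
    and "\<And>k. k < K \<Longrightarrow> s k \<in> S" "\<And>k. k < K \<Longrightarrow> t k \<in> S"
    and "\<exists>k<K. s k \<noteq> t k"
  shows "\<exists>j\<in>J. r ^ K * (\<delta> - 2 * r / (1 - r))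
           \<le> cmod (\<Sum>k<K. of_real (r ^ k) * (y (s k) j - y (t k) j))"
  using assms(6-)
proof (induction K arbitrary: s t)
  case 0
  then show ?case by simp
next
  case (Suc K)
  define \<gamma> where "\<gamma> = \<delta> - 2 * r / (1 - r)"
  have \<gamma>: "0 \<le> \<gamma>" using \<delta> by (simp add: \<gamma>_def)
  define tail where
    "tail j = (\<Sum>k<K. of_real (r ^ k) * (y (s (Suc k)) j - y (t (Suc k)) j))" for j
  have split: "(\<Sum>k<Suc K. of_real (r ^ k) * (y (s k) j - y (t k) j))
      = (y (s 0) j - y (t 0) j) + of_real r * tail j" for j
    unfolding sum.lessThan_Suc_shift tail_def by (simp add: sum_distrib_left mult.assoc)
  show ?case
  proof (cases "s 0 = t 0")
    case True
    have "\<exists>k<K. s (Suc k) \<noteq> t (Suc k)"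
      using Suc.prems(3) True by (metis less_Suc_eq_0_disj)
    then obtain j where j: "j \<in> J" "r ^ K * \<gamma> \<le> cmod (tail j)"
      using Suc.IH[of "\<lambda>k. s (Suc k)" "\<lambda>k. t (Suc k)"] Suc.prems(1,2)
      unfolding tail_def \<gamma>_def by auto
    have "r ^ Suc K * \<gamma> \<le> cmod (of_real r * tail j)"
      using j(2) r by (simp add: norm_mult mult.assoc)
    with j(1) True show ?thesis
      unfolding split \<gamma>_def by (intro bexI[of _ j]) simp_all
  next
    case False
    then obtain j where j: "j \<in> J" "\<delta> \<le> cmod (y (s 0) j - y (t 0) j)"
      using sep Suc.prems(1,2) by blast
    have diff: "cmod (y (s (Suc k)) j - y (t (Suc k)) j) \<le> 2" if "k < K" for k
      using norm_triangle_ineq4[of "y (s (Suc k)) j" "y (t (Suc k)) j"]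
        bounded[of "s (Suc k)" j] bounded[of "t (Suc k)" j] Suc.prems(1,2)[of "Suc k"] that j(1)
      by simp
    have "cmod (tail j) \<le> (\<Sum>k<K. r ^ k * 2)"
      unfolding tail_def
      by (intro sum_norm_le) (use r diff in \<open>auto simp: norm_mult norm_power intro!: mult_left_mono\<close>)
    also have "\<dots> \<le> 1 / (1 - r) * 2"
      unfolding sum_distrib_right[symmetric]
      using sum_power_le_geometric[OF r] by (intro mult_right_mono) auto
    finally have "cmod (of_real r * tail j) \<le> 2 * r / (1 - r)"
      using r mult_left_mono[of "cmod (tail j)" "1 / (1 - r) * 2" r] by (simp add: norm_mult mult.commute)
    moreover have "cmod (y (s 0) j - y (t 0) j)
        \<le> cmod (y (s 0) j - y (t 0) j + of_real r * tail j) + cmod (of_real r * tail j)"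
      by (metis add_diff_cancel_right' norm_triangle_ineq4)
    moreover have "r ^ Suc K * \<gamma> \<le> 1 * \<gamma>"
      using r \<gamma> by (intro mult_right_mono power_le_one) auto
    ultimately show ?thesis
      using j unfolding split \<gamma>_def by (intro bexI[of _ j]) auto
  qed
qed

text \<open>
  The hypotheses say that the rows \<open>y g\<close> are \<open>\<delta>\<close>-separated points of the unit ball of the
  maximum norm, all in the span of the \<open>card I\<close> vectors \<open>a i\<close>.  Expansions of length
  \<open>K\<close> in base \<open>1 / r\<close> with these points as digits are so far apart that counting grid cells
  bounds the number \<open>card S ^ K\<close> of expansions by a constant times \<open>(1 / r) ^ (K * card I)\<close>; this
  replaces the usual comparison of volumes.
\<close>

lemma card_separated_le:
  fixes y :: "'s \<Rightarrow> 'j \<Rightarrow> complex" and x :: "'s \<Rightarrow> 'i \<Rightarrow> real" and r \<delta> :: real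
  assumes r: "0 < r" "r < 1" and \<delta>: "2 * r / (1 - r) < \<delta>"
    and finite: "finite S" "finite I" "finite J"
    and y: "\<And>g j. g \<in> S \<Longrightarrow> j \<in> J \<Longrightarrow> y g j = (\<Sum>i\<in>I. of_real (x g i) * a i j)"
    and bounded: "\<And>g j. g \<in> S \<Longrightarrow> j \<in> J \<Longrightarrow> cmod (y g j) \<le> 1"
    and sep: "\<And>g h. g \<in> S \<Longrightarrow> h \<in> S \<Longrightarrow> g \<noteq> h \<Longrightarrow> \<exists>j\<in>J. \<delta> \<le> cmod (y g j - y h j)"
  shows "real (card S) \<le> (1 / r) ^ card I"
proof -
  define \<gamma> where "\<gamma> = \<delta> - 2 * r / (1 - r)"
  have \<gamma>: "0 < \<gamma>" using \<delta> by (simp add: \<gamma>_def)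
  define X where "X = (\<Sum>g\<in>S. \<Sum>i\<in>I. \<bar>x g i\<bar>)"
  have X: "\<bar>x g i\<bar> \<le> X" if "g \<in> S" "i \<in> I" for g i
  proof -
    have "\<bar>x g i\<bar> \<le> (\<Sum>i\<in>I. \<bar>x g i\<bar>)"
      using finite that by (intro member_le_sum) auto
    also have "\<dots> \<le> X"
      unfolding X_def using finite that
      by (intro member_le_sum[where f = "\<lambda>g. \<Sum>i\<in>I. \<bar>x g i\<bar>"]) (auto intro: sum_nonneg)
    finally show ?thesis .
  qed
  have X0: "0 \<le> X" unfolding X_def by (intro sum_nonneg) auto
  \<comment> \<open>The summand 1 keeps \<open>A\<close> positive and makes the bound below strict,
    so that expansions in one cell come out strictly too close.\<close>
  define A where "A = 1 + (\<Sum>j\<in>J. \<Sum>i\<in>I. cmod (a i j))"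
  have A: "(\<Sum>i\<in>I. cmod (a i j)) < A" if "j \<in> J" for j
  proof -
    have "(\<Sum>i\<in>I. cmod (a i j)) \<le> (\<Sum>j\<in>J. \<Sum>i\<in>I. cmod (a i j))"
      using finite that
      by (intro member_le_sum[where f = "\<lambda>j. \<Sum>i\<in>I. cmod (a i j)"]) (auto intro: sum_nonneg)
    then show ?thesis by (simp add: A_def)
  qed
  have A0: "0 < A" unfolding A_def by (intro add_pos_nonneg sum_nonneg) auto
  \<comment> \<open>With this choice \<open>2 * D\<close> below equals
    \<open>(C - 3) / r ^ K\<close>, while \<open>C\<close> itself does not depend on
    \<open>K\<close>. The 3 absorbs the rounding in
    \<open>2 * \<lceil>D\<rceil> + 1 \<le> 2 * D + 3\<close>.\<close>
  define C where "C = 2 * (X * A / ((1 - r) * \<gamma>)) + 3"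
  have "(real (card S) * r ^ card I) ^ K \<le> C ^ card I" for K
  proof -
    define T where "T = {..<K} \<rightarrow>\<^sub>E S"
    define F where "F s i = (\<Sum>k<K. r ^ k * x (s k) i)" for s :: "nat \<Rightarrow> 's" and i
    \<comment> \<open>The mesh is chosen so that \<open>\<epsilon> * A\<close> is exactly the gap
      \<open>r ^ K * \<gamma>\<close> guaranteed between distinct expansions.\<close>
    define \<epsilon> where "\<epsilon> = \<gamma> * r ^ K / A"
    have \<epsilon>: "0 < \<epsilon>" using \<gamma> r A0 by (simp add: \<epsilon>_def)
    define D where "D = X / (1 - r) / \<epsilon>"
    define cell where "cell s = restrict (\<lambda>i. \<lfloor>F s i / \<epsilon>\<rfloor>) I" for s
    \<comment> \<open>Two expansions in one cell have coefficients within \<open>\<epsilon>\<close>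
      of each other, hence are less than the guaranteed gap apart in every coordinate
      \<open>j\<close>.\<close>
    have "inj_on cell T"
    proof (rule inj_onI, rule ccontr)
      fix s t assume s: "s \<in> T" and t: "t \<in> T" and eq: "cell s = cell t" and neq: "s \<noteq> t"
      have differ: "\<exists>k<K. s k \<noteq> t k"
        using s t neq unfolding T_def by (metis PiE_ext lessThan_iff)
      have in_S: "\<And>k. k < K \<Longrightarrow> s k \<in> S" "\<And>k. k < K \<Longrightarrow> t k \<in> S"
        using s t unfolding T_def by auto
      have "\<exists>j\<in>J. r ^ K * \<gamma> \<le> cmod (\<Sum>k<K. of_real (r ^ k) * (y (s k) j - y (t k) j))"
        unfolding \<gamma>_def using r less_imp_le[OF \<delta>] bounded sep in_S differ
        by (rule digit_expansions_separated)
      then obtain j where j: "j \<in> J"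
        and far: "r ^ K * \<gamma> \<le> cmod (\<Sum>k<K. of_real (r ^ k) * (y (s k) j - y (t k) j))"
        by blast
      have "(\<Sum>k<K. of_real (r ^ k) * (y (s k) j - y (t k) j))
          = (\<Sum>k<K. \<Sum>i\<in>I. of_real (r ^ k * (x (s k) i - x (t k) i)) * a i j)"
        using in_S j
        by (intro sum.cong) (simp_all add: y sum_distrib_left sum_subtractf[symmetric] algebra_simps)
      also have "\<dots> = (\<Sum>i\<in>I. \<Sum>k<K. of_real (r ^ k * (x (s k) i - x (t k) i)) * a i j)"
        by (rule sum.swap)
      also have "\<dots> = (\<Sum>i\<in>I. of_real (F s i - F t i) * a i j)"
        unfolding sum_distrib_right[symmetric]
        by (simp add: F_def sum_subtractf right_diff_distrib)
      also have "cmod \<dots> \<le> (\<Sum>i\<in>I. \<epsilon> * cmod (a i j))"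
      proof (intro sum_norm_le)
        fix i assume i: "i \<in> I"
        have "\<lfloor>F s i / \<epsilon>\<rfloor> = \<lfloor>F t i / \<epsilon>\<rfloor>"
          using fun_cong[OF eq, of i] i by (simp add: cell_def)
        then have "\<bar>F s i / \<epsilon> - F t i / \<epsilon>\<bar> < 1" by linarith
        then have "\<bar>F s i - F t i\<bar> / \<epsilon> < 1"
          using \<epsilon> by (simp add: diff_divide_distrib[symmetric])
        then have "\<bar>F s i - F t i\<bar> \<le> \<epsilon>"
          using \<epsilon> by simp
        then show "cmod (of_real (F s i - F t i) * a i j) \<le> \<epsilon> * cmod (a i j)"
          unfolding norm_mult norm_of_real by (intro mult_right_mono) auto
      qed
      also have "\<dots> < \<epsilon> * A"
        unfolding sum_distrib_left[symmetric] using A[OF j] \<epsilon> by simp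
      also have "\<dots> = r ^ K * \<gamma>" using A0 by (simp add: \<epsilon>_def)
      finally show False using far by simp
    qed
    moreover have "cell ` T \<subseteq> I \<rightarrow>\<^sub>E {- \<lceil>D\<rceil>..\<lceil>D\<rceil>}"
    proof
      fix c assume "c \<in> cell ` T"
      then obtain s where s: "s \<in> T" "c = cell s" by auto
      have "\<lfloor>F s i / \<epsilon>\<rfloor> \<in> {- \<lceil>D\<rceil>..\<lceil>D\<rceil>}" if i: "i \<in> I" for i
      proof -
        have "\<bar>F s i\<bar> \<le> (\<Sum>k<K. r ^ k * X)"
          unfolding F_def
          using s(1) r X i
          by (intro order.trans[OF sum_abs] sum_mono) (auto simp: abs_mult T_def intro!: mult_left_mono)
        also have "\<dots> \<le> 1 / (1 - r) * X"
          unfolding sum_distrib_right[symmetric]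
          using sum_power_le_geometric[OF r] X0 by (rule mult_right_mono)
        finally have "\<bar>F s i\<bar> / \<epsilon> \<le> D"
          unfolding D_def using \<epsilon> by (intro divide_right_mono) auto
        then have "\<bar>F s i / \<epsilon>\<bar> \<le> D" using \<epsilon> by simp
        then have "- D \<le> F s i / \<epsilon>" "F s i / \<epsilon> \<le> D" by linarith+
        then show ?thesis by simp linarith
      qed
      then show "c \<in> I \<rightarrow>\<^sub>E {- \<lceil>D\<rceil>..\<lceil>D\<rceil>}"
        unfolding s(2) cell_def by auto
    qed
    ultimately have "card T \<le> card (I \<rightarrow>\<^sub>E {- \<lceil>D\<rceil>..\<lceil>D\<rceil>})"
      using finite by (intro card_inj_on_le finite_PiE) auto
    then have "card S ^ K \<le> nat (2 * \<lceil>D\<rceil> + 1) ^ card I"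
      using finite by (simp add: T_def card_PiE)
    then have "real (card S) ^ K \<le> real (nat (2 * \<lceil>D\<rceil> + 1)) ^ card I"
      by (metis of_nat_mono of_nat_power)
    also have "\<dots> \<le> (C / r ^ K) ^ card I"
    proof (rule power_mono)
      have D0: "0 \<le> D" unfolding D_def using X0 r \<epsilon> by simp
      then have "real (nat (2 * \<lceil>D\<rceil> + 1)) = 2 * of_int \<lceil>D\<rceil> + 1"
        by simp
      also have "\<dots> \<le> 2 * D + 3" by linarith
      also have "2 * D = (C - 3) / r ^ K"
        unfolding D_def C_def \<epsilon>_def using A0 by (simp add: field_simps)
      also have "(C - 3) / r ^ K + 3 \<le> (C - 3) / r ^ K + 3 / r ^ K"
        using r by (simp add: field_simps power_le_one)
      also have "\<dots> = C / r ^ K" by (simp add: add_divide_distrib[symmetric])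
      finally show "real (nat (2 * \<lceil>D\<rceil> + 1)) \<le> C / r ^ K" by simp
    qed simp
    finally have "real (card S) ^ K * (r ^ K) ^ card I \<le> C ^ card I"
      using r by (simp add: power_divide field_simps)
    then show ?thesis
      by (simp add: power_mult_distrib power_mult[symmetric] mult.commute)
  qed
  \<comment> \<open>All powers of this number lie below one constant, so the number cannot exceed
    1.\<close>
  then have "real (card S) * r ^ card I \<le> 1"
    by (metis linorder_not_le not_less_iff_gr_or_eq real_arch_pow)
  then show ?thesis using r by (simp add: power_divide field_simps)
qed

text \<open>Splitting each coefficient into real and imaginary part gives real combinations of the
  vectors \<open>a i\<close> and \<open>\<i> * a i\<close>; this doubles the index set and hence the
  exponent.\<close>

lemma card_separated_le_complex:
  fixes y :: "'s \<Rightarrow> 'j \<Rightarrow> complex" and x :: "'s \<Rightarrow> 'i \<Rightarrow> complex" and r \<delta> :: real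
  assumes "0 < r" "r < 1" and "2 * r / (1 - r) < \<delta>"
    and finite: "finite S" "finite I" "finite J"
    and y: "\<And>g j. g \<in> S \<Longrightarrow> j \<in> J \<Longrightarrow> y g j = (\<Sum>i\<in>I. x g i * a i j)"
    and "\<And>g j. g \<in> S \<Longrightarrow> j \<in> J \<Longrightarrow> cmod (y g j) \<le> 1"
    and "\<And>g h. g \<in> S \<Longrightarrow> h \<in> S \<Longrightarrow> g \<noteq> h \<Longrightarrow> \<exists>j\<in>J. \<delta> \<le> cmod (y g j - y h j)"
  shows "real (card S) \<le> (1 / r) ^ (2 * card I)"
proof -
  define x' where "x' g = case_sum (\<lambda>i. Re (x g i)) (\<lambda>i. Im (x g i))" for g
  define a' where "a' p j = case_sum (\<lambda>i. a i j) (\<lambda>i. \<i> * a i j) p" for p j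
  have "y g j = (\<Sum>p\<in>I <+> I. of_real (x' g p) * a' p j)" if "g \<in> S" "j \<in> J" for g j
  proof -
    have "y g j = (\<Sum>i\<in>I. (of_real (Re (x g i)) + of_real (Im (x g i)) * \<i>) * a i j)"
      unfolding y[OF that] by (intro sum.cong) (auto simp: complex_eq_iff)
    also have "\<dots> = (\<Sum>p\<in>I <+> I. of_real (x' g p) * a' p j)"
      using finite by (simp add: sum.Plus x'_def a'_def sum.distrib algebra_simps)
    finally show ?thesis .
  qed
  then have "real (card S) \<le> (1 / r) ^ card (I <+> I)"
    using assms by (intro card_separated_le[of r \<delta> S "I <+> I" J y x' a']) auto
  then show ?thesis
    using finite by (simp add: card_Plus mult_2)
qed

section \<open>Simple groups\<close>

text \<open>If \<open>z\<close> commutes with all of \<open>C\<close>, it commutes with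
  \<open>inv w \<otimes> c \<otimes> w\<close>, which is again in \<open>C\<close>; conjugating this
  relation by \<open>w\<close> shows that \<open>w \<otimes> z \<otimes> inv w\<close> commutes with
  \<open>c\<close>.\<close>

lemma (in group) centralizer_normal:
  assumes C: "C \<subseteq> carrier G"
    and conj: "\<And>z c. z \<in> carrier G \<Longrightarrow> c \<in> C \<Longrightarrow> z \<otimes> c \<otimes> inv z \<in> C"
  shows "{z \<in> carrier G. \<forall>c\<in>C. z \<otimes> c = c \<otimes> z} \<lhd> G" (is "?Z \<lhd> G")
proof (rule normal_invI)
  show "subgroup ?Z G"
  proof (rule subgroupI)
    show "?Z \<noteq> {}" using C by (auto intro!: exI[of _ \<one>])
    fix z assume z: "z \<in> ?Z"
    have "inv z \<otimes> c = c \<otimes> inv z" if "c \<in> C" for c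
    proof -
      have c: "c \<in> carrier G" and zc: "z \<otimes> c = c \<otimes> z" using C z that by auto
      have "inv z \<otimes> (z \<otimes> c) \<otimes> inv z = inv z \<otimes> (c \<otimes> z) \<otimes> inv z" by (simp only: zc)
      moreover have "inv z \<otimes> (z \<otimes> c) = c" using z c by (simp add: m_assoc[symmetric])
      moreover have "inv z \<otimes> (c \<otimes> z) \<otimes> inv z = inv z \<otimes> c" using z c by (simp add: m_assoc)
      ultimately show ?thesis by simp
    qed
    then show "inv z \<in> ?Z" using z by simp
  next
    fix z w assume z: "z \<in> ?Z" and w: "w \<in> ?Z"
    have "z \<otimes> w \<otimes> c = c \<otimes> (z \<otimes> w)" if "c \<in> C" for c
    proof -
      have c: "c \<in> carrier G" using C that by auto
      have zc: "z \<otimes> c = c \<otimes> z" and wc: "w \<otimes> c = c \<otimes> w" using z w that by auto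
      have "z \<otimes> w \<otimes> c = z \<otimes> (w \<otimes> c)" using z w c m_assoc by simp
      also have "\<dots> = z \<otimes> c \<otimes> w" unfolding wc using z w c m_assoc by simp
      also note zc
      also have "c \<otimes> z \<otimes> w = c \<otimes> (z \<otimes> w)" using z w c by (simp add: m_assoc)
      finally show ?thesis .
    qed
    then show "z \<otimes> w \<in> ?Z" using z w by simp
  qed auto
next
  fix w z assume w: "w \<in> carrier G" and z: "z \<in> ?Z"
  have "w \<otimes> z \<otimes> inv w \<otimes> c = c \<otimes> (w \<otimes> z \<otimes> inv w)" if c: "c \<in> C" for c
  proof -
    have cc: "c \<in> carrier G" and zc: "z \<in> carrier G" using C c z by auto
    define d where "d = inv w \<otimes> c \<otimes> w"
    have d: "d \<in> carrier G" using w cc by (simp add: d_def)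
    have "d \<in> C"
      using conj[of "inv w" c] w c by (simp add: d_def)
    then have zd: "z \<otimes> d = d \<otimes> z" using z by simp
    have c_eq: "c = w \<otimes> d \<otimes> inv w"
      using w cc by (simp add: d_def m_assoc) (simp add: m_assoc[symmetric])
    have cancel: "inv w \<otimes> (w \<otimes> u) = u" if "u \<in> carrier G" for u
      using w that by (simp add: m_assoc[symmetric])
    have "w \<otimes> z \<otimes> inv w \<otimes> c = w \<otimes> (z \<otimes> d) \<otimes> inv w"
      using w zc d by (simp add: c_eq m_assoc cancel)
    also have "\<dots> = c \<otimes> (w \<otimes> z \<otimes> inv w)"
      unfolding zd using w zc d by (simp add: c_eq m_assoc cancel)
    finally show ?thesis .
  qed
  then show "w \<otimes> z \<otimes> inv w \<in> ?Z" using w z by auto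
qed

text \<open>The center is normal and contains \<open>g\<close>, so it is the whole group. In an
  abelian group the subgroup generated by \<open>g\<close> is normal, so it is the whole group as
  well.\<close>

lemma (in simple_group) central_imp_cyclic:
  assumes g: "g \<in> carrier G" "g \<noteq> \<one>" and central: "\<And>z. z \<in> carrier G \<Longrightarrow> g \<otimes> z = z \<otimes> g"
  shows "cyclic_group G"
proof -
  have "{z \<in> carrier G. \<forall>c\<in>carrier G. z \<otimes> c = c \<otimes> z} \<lhd> G"
    by (rule centralizer_normal) auto
  then have "{z \<in> carrier G. \<forall>c\<in>carrier G. z \<otimes> c = c \<otimes> z} = carrier G"
    using no_real_normal_subgroup g central by blast
  then have comm: "z \<otimes> c = c \<otimes> z" if "z \<in> carrier G" "c \<in> carrier G" for z c
    using that by blast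
  have sub: "subgroup (generate G {g}) G"
    using g by (intro generate_is_subgroup) auto
  have "generate G {g} \<lhd> G"
  proof (rule normal_invI[OF sub])
    fix z h assume z: "z \<in> carrier G" and h: "h \<in> generate G {g}"
    have "h \<in> carrier G" using sub h subgroup.mem_carrier by metis
    then have "z \<otimes> h \<otimes> inv z = h" using z comm[of z h] by (simp add: m_assoc)
    then show "z \<otimes> h \<otimes> inv z \<in> generate G {g}" using h by simp
  qed
  moreover have "g \<in> generate G {g}" by (auto intro: generate.incl)
  ultimately have "generate G {g} = carrier G"
    using no_real_normal_subgroup g(2) by blast
  then show ?thesis
    using g(1) generate_pow[OF g(1)] unfolding cyclic_group
    by (intro bexI[of _ g]) (auto simp: full_SetCompr_eq)
qed

text \<open>The centralizer of the conjugacy class of \<open>g\<close> is normal and contains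
  \<open>g\<close>, hence is everything. As \<open>g\<close> lies in its own class, it is
  central.\<close>

lemma (in simple_group) commutes_with_conjugates_imp_cyclic:
  assumes g: "g \<in> carrier G" "g \<noteq> \<one>"
    and comm: "\<And>z. z \<in> carrier G \<Longrightarrow> g \<otimes> (z \<otimes> g \<otimes> inv z) = z \<otimes> g \<otimes> inv z \<otimes> g"
  shows "cyclic_group G"
proof -
  define C where "C = (\<lambda>z. z \<otimes> g \<otimes> inv z) ` carrier G"
  have C: "C \<subseteq> carrier G" using g by (auto simp: C_def)
  have conj: "w \<otimes> c \<otimes> inv w \<in> C" if w: "w \<in> carrier G" and c: "c \<in> C" for w c
  proof -
    obtain z where z: "z \<in> carrier G" "c = z \<otimes> g \<otimes> inv z" using c by (auto simp: C_def)
    have "w \<otimes> c \<otimes> inv w = (w \<otimes> z) \<otimes> g \<otimes> inv (w \<otimes> z)"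
      using w z g by (simp add: m_assoc inv_mult_group)
    then show ?thesis using w z(1) by (auto simp: C_def)
  qed
  have "g \<in> {z \<in> carrier G. \<forall>c\<in>C. z \<otimes> c = c \<otimes> z}"
    using g comm by (auto simp: C_def)
  then have Z: "{z \<in> carrier G. \<forall>c\<in>C. z \<otimes> c = c \<otimes> z} = carrier G"
    using no_real_normal_subgroup[OF centralizer_normal[OF C conj]] g(2) by blast
  have "g \<in> C" using g(1) unfolding C_def by (intro image_eqI[of _ _ \<one>]) auto
  then have "g \<otimes> z = z \<otimes> g" if "z \<in> carrier G" for z
    using Z that by (metis (mono_tags, lifting) mem_Collect_eq)
  then show ?thesis by (rule central_imp_cyclic[OF g])
qed

section \<open>Invariant norms\<close>

text \<open>A nonempty basis means a nonzero space: the maximum defining \<open>inv_norm\<close> is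
  then over a nonempty set, and unit vectors exist.\<close>

locale finite_group_representation =
  finite_dimensional_vector_space scale B + group G
  for scale :: "complex \<Rightarrow> 'v::ab_group_add \<Rightarrow> 'v" (infixr \<open>*s\<close> 75) and B and G (structure) +
  fixes \<rho> :: "'g \<Rightarrow> 'v \<Rightarrow> 'v"
  assumes rep: "\<rho> \<in> hom G (GL scale)"
    and finite_carrier: "finite (carrier G)"
    and B_nonempty: "B \<noteq> {}"
begin

lemma linear_rep: "g \<in> carrier G \<Longrightarrow> Vector_Spaces.linear scale scale (\<rho> g)"
  using hom_in_carrier[OF rep, of g] by (simp add: GL_def)

lemma rep_mult: "g \<in> carrier G \<Longrightarrow> h \<in> carrier G \<Longrightarrow> \<rho> (g \<otimes> h) v = \<rho> g (\<rho> h v)"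
  using hom_mult[OF rep, of g h] by (simp add: GL_def)

lemma rep_one: "\<rho> \<one> v = v"
proof -
  have "\<rho> \<one> = \<one>\<^bsub>GL scale\<^esub>"
    using hom_one[OF rep group_axioms group_GL[OF vector_space_axioms]] .
  then show ?thesis by (simp add: GL_def)
qed

lemma rep_diff: "g \<in> carrier G \<Longrightarrow> \<rho> g (v - w) = \<rho> g v - \<rho> g w"
  using linear_rep[of g] by (metis Vector_Spaces.linear.axioms(3) module_hom.diff)

lemma rep_scale: "g \<in> carrier G \<Longrightarrow> \<rho> g (c *s v) = c *s \<rho> g v"
  using linear_rep[of g] by (metis Vector_Spaces.linear.axioms(3) module_hom.scale)

lemma rep_inv: "g \<in> carrier G \<Longrightarrow> \<rho> (inv g) (\<rho> g v) = v" "g \<in> carrier G \<Longrightarrow> \<rho> g (\<rho> (inv g) v) = v"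
  by (simp_all add: rep_mult[symmetric] rep_one)

definition matrix_coeff :: "'g \<Rightarrow> 'v \<Rightarrow> 'v \<Rightarrow> complex" where
  "matrix_coeff g b v = representation B (\<rho> g v) b"

lemma linear_representation_B: "Vector_Spaces.linear scale (*) (\<lambda>v. representation B v b)"
  using independent_Basis span_Basis by (intro linear_representation) auto

lemma linear_matrix_coeff:
  assumes "g \<in> carrier G"
  shows "Vector_Spaces.linear scale (*) (matrix_coeff g b)"
  using Vector_Spaces.linear_compose[OF linear_rep[OF assms] linear_representation_B]
  by (simp add: matrix_coeff_def[abs_def] comp_def)

lemma linear_functional_eq_sum:
  assumes "Vector_Spaces.linear scale (*) f"
  shows "f v = (\<Sum>c\<in>B. representation B v c * f c)"
proof -
  interpret f: Vector_Spaces.linear scale "(*)" f by fact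
  have "(\<Sum>c\<in>B. representation B v c *s c) = v"
    using independent_Basis span_Basis finite_Basis by (intro sum_representation_eq) auto
  then have "f v = f (\<Sum>c\<in>B. representation B v c *s c)" by simp
  then show ?thesis by (simp add: f.sum f.scale)
qed

text \<open>Seen as a function of \<open>g\<close>, this is a combination of the entries of the
  matrix of \<open>\<rho> g\<close>, with factors depending only on \<open>k\<close>,
  \<open>b\<close> and \<open>v\<close>. It is the form required by
  \<open>card_separated_le_complex\<close>, with index set \<open>B \<times> B\<close>.\<close>

lemma matrix_coeff_rep:
  assumes "g \<in> carrier G" "k \<in> carrier G"
  shows "matrix_coeff k b (\<rho> g v) =
    (\<Sum>(c, c')\<in>B \<times> B. matrix_coeff g c' c * (representation B v c * matrix_coeff k b c'))"
proof -
  have "Vector_Spaces.linear scale (*) (\<lambda>v. matrix_coeff k b (\<rho> g v))"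
    using Vector_Spaces.linear_compose[OF linear_rep linear_matrix_coeff] assms
    by (simp add: comp_def)
  from linear_functional_eq_sum[OF this, of v]
  have "matrix_coeff k b (\<rho> g v) = (\<Sum>c\<in>B. representation B v c * matrix_coeff k b (\<rho> g c))" .
  also have "\<dots> = (\<Sum>c\<in>B. \<Sum>c'\<in>B. matrix_coeff g c' c * (representation B v c * matrix_coeff k b c'))"
    by (subst linear_functional_eq_sum[OF linear_matrix_coeff[OF assms(2)]])
      (simp add: matrix_coeff_def[of g] sum_distrib_left mult.left_commute)
  finally show ?thesis by (simp add: sum.cartesian_product)
qed

text \<open>The maximum norm of coordinates in \<open>B\<close>, made invariant by a further maximum
  over the orbit of \<open>v\<close>. No inner product is used: a maximum of finitely many
  functionals matches the coordinatewise hypotheses of the counting lemma.\<close>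

definition inv_norm :: "'v \<Rightarrow> real" where
  "inv_norm v = Max ((\<lambda>(k, b). cmod (matrix_coeff k b v)) ` (carrier G \<times> B))"

lemma finite_coeffs: "finite ((\<lambda>(k, b). cmod (matrix_coeff k b v)) ` (carrier G \<times> B))"
  using finite_carrier finite_Basis by simp

lemma coeffs_nonempty: "(\<lambda>(k, b). cmod (matrix_coeff k b v)) ` (carrier G \<times> B) \<noteq> {}"
  using B_nonempty by auto

lemma norm_matrix_coeff_le: "k \<in> carrier G \<Longrightarrow> b \<in> B \<Longrightarrow> cmod (matrix_coeff k b v) \<le> inv_norm v"
  unfolding inv_norm_def by (rule Max_ge[OF finite_coeffs]) auto

lemma inv_norm_leI:
  "(\<And>k b. k \<in> carrier G \<Longrightarrow> b \<in> B \<Longrightarrow> cmod (matrix_coeff k b v) \<le> c) \<Longrightarrow> inv_norm v \<le> c"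
  unfolding inv_norm_def by (subst Max_le_iff[OF finite_coeffs coeffs_nonempty]) auto

lemma inv_norm_attained:
  obtains k b where "k \<in> carrier G" "b \<in> B" "inv_norm v = cmod (matrix_coeff k b v)"
  using Max_in[OF finite_coeffs coeffs_nonempty, of v] unfolding inv_norm_def[symmetric] by auto

lemma inv_norm_nonneg: "0 \<le> inv_norm v"
  by (rule inv_norm_attained[of v]) simp

lemma matrix_coeff_diff:
  "k \<in> carrier G \<Longrightarrow> matrix_coeff k b (v - w) = matrix_coeff k b v - matrix_coeff k b w"
  using linear_matrix_coeff[of k b] by (metis Vector_Spaces.linear.axioms(3) module_hom.diff)

lemma matrix_coeff_scale:
  "k \<in> carrier G \<Longrightarrow> matrix_coeff k b (c *s v) = c * matrix_coeff k b v"
  using linear_matrix_coeff[of k b] by (metis Vector_Spaces.linear.axioms(3) module_hom.scale)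

lemma inv_norm_diff: "inv_norm (v - w) \<le> inv_norm v + inv_norm w"
proof (rule inv_norm_leI)
  fix k b assume "k \<in> carrier G" "b \<in> B"
  then show "cmod (matrix_coeff k b (v - w)) \<le> inv_norm v + inv_norm w"
    using norm_triangle_ineq4[of "matrix_coeff k b v" "matrix_coeff k b w"]
      norm_matrix_coeff_le[of k b v] norm_matrix_coeff_le[of k b w]
    by (simp add: matrix_coeff_diff)
qed

lemma inv_norm_scale: "inv_norm (c *s v) = cmod c * inv_norm v"
proof (rule antisym)
  show "inv_norm (c *s v) \<le> cmod c * inv_norm v"
    by (rule inv_norm_leI)
      (simp add: matrix_coeff_scale norm_mult norm_matrix_coeff_le mult_left_mono)
  obtain k b where "k \<in> carrier G" "b \<in> B" "inv_norm v = cmod (matrix_coeff k b v)"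
    by (rule inv_norm_attained)
  then show "cmod c * inv_norm v \<le> inv_norm (c *s v)"
    using norm_matrix_coeff_le[of k b "c *s v"] by (simp add: matrix_coeff_scale norm_mult)
qed

lemma inv_norm_eq_0D:
  assumes "inv_norm v = 0"
  shows "v = 0"
proof -
  \<comment> \<open>The functionals with \<open>k = \<one>\<close> are already the coordinates in
    the basis.\<close>
  have "representation B v b = 0" if "b \<in> B" for b
    using norm_matrix_coeff_le[of \<one> b v] assms that by (simp add: matrix_coeff_def rep_one)
  moreover have "(\<Sum>c\<in>B. representation B v c *s c) = v"
    using independent_Basis span_Basis finite_Basis by (intro sum_representation_eq) auto
  ultimately show ?thesis by simp
qed

lemma inv_norm_0: "inv_norm 0 = 0"
  using inv_norm_scale[of 0 0] by simp

text \<open>The functional for \<open>k\<close> at \<open>\<rho> g v\<close> is the functional for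
  \<open>k \<otimes> g\<close> at \<open>v\<close>, so no new values arise.\<close>

lemma inv_norm_rep_le: "g \<in> carrier G \<Longrightarrow> inv_norm (\<rho> g v) \<le> inv_norm v"
proof (rule inv_norm_leI)
  fix k b assume "g \<in> carrier G" "k \<in> carrier G" "b \<in> B"
  then show "cmod (matrix_coeff k b (\<rho> g v)) \<le> inv_norm v"
    using norm_matrix_coeff_le[of "k \<otimes> g" b v] by (simp add: matrix_coeff_def rep_mult)
qed

lemma inv_norm_rep: "g \<in> carrier G \<Longrightarrow> inv_norm (\<rho> g v) = inv_norm v"
  using inv_norm_rep_le[of g v] inv_norm_rep_le[of "inv g" "\<rho> g v"] by (simp add: rep_inv)

section \<open>Operator distance from the identity\<close>

lemma ex_unit: "\<exists>v. inv_norm v = 1"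
proof -
  obtain b where b: "b \<in> B" using B_nonempty by auto
  then have "b \<noteq> 0" using independent_Basis dependent_zero by metis
  then have "inv_norm b \<noteq> 0" using inv_norm_eq_0D by blast
  then have "inv_norm (of_real (1 / inv_norm b) *s b) = 1"
    using inv_norm_nonneg[of b] by (simp add: inv_norm_scale norm_divide)
  then show ?thesis ..
qed

text \<open>The operator norm of \<open>\<rho> g - 1\<close> with respect to
  \<open>inv_norm\<close>.\<close>

definition displacement :: "'g \<Rightarrow> real" where
  "displacement g = (SUP v\<in>{v. inv_norm v = 1}. inv_norm (\<rho> g v - v))"

lemma displacement_leI:
  "(\<And>v. inv_norm v = 1 \<Longrightarrow> inv_norm (\<rho> g v - v) \<le> c) \<Longrightarrow> displacement g \<le> c"
  unfolding displacement_def using ex_unit by (intro cSUP_least) auto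

lemma inv_norm_le_displacement:
  assumes g: "g \<in> carrier G"
  shows "inv_norm (\<rho> g v - v) \<le> displacement g * inv_norm v"
proof (cases "inv_norm v = 0")
  case True
  then have "v = 0" by (rule inv_norm_eq_0D)
  moreover have "\<rho> g 0 = 0" using rep_scale[OF g, of 0 0] by simp
  ultimately show ?thesis by (simp add: inv_norm_0)
next
  case False
  then have pos: "0 < inv_norm v" using inv_norm_nonneg[of v] by simp
  define u where "u = of_real (1 / inv_norm v) *s v"
  have u: "inv_norm u = 1" using pos by (simp add: u_def inv_norm_scale norm_divide)
  \<comment> \<open>The supremum is an upper bound only for a bounded set; invariance of the norm
    and the triangle inequality give the bound 2.\<close>
  have "bdd_above ((\<lambda>v. inv_norm (\<rho> g v - v)) ` {v. inv_norm v = 1})"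
  proof (rule bdd_aboveI2)
    fix v assume "v \<in> {v. inv_norm v = 1}"
    then show "inv_norm (\<rho> g v - v) \<le> 2"
      using inv_norm_diff[of "\<rho> g v" v] inv_norm_rep[OF g, of v] by simp
  qed
  then have "inv_norm (\<rho> g u - u) \<le> displacement g"
    unfolding displacement_def using u by (intro cSUP_upper) auto
  moreover have "\<rho> g u - u = of_real (1 / inv_norm v) *s (\<rho> g v - v)"
    using g by (simp add: u_def rep_scale scale_right_diff_distrib)
  moreover have "inv_norm (of_real (1 / inv_norm v) *s (\<rho> g v - v)) = inv_norm (\<rho> g v - v) / inv_norm v"
    using pos by (simp add: inv_norm_scale norm_divide)
  ultimately show ?thesis
    using pos by (simp add: pos_divide_le_eq)
qed

lemma displacement_nonneg: "g \<in> carrier G \<Longrightarrow> 0 \<le> displacement g"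
  using ex_unit inv_norm_le_displacement[of g] inv_norm_nonneg
  by (metis mult.right_neutral order.trans)

lemma displacement_eq_0D:
  assumes "g \<in> carrier G" "displacement g = 0"
  shows "\<rho> g = id"
proof
  fix v
  have "inv_norm (\<rho> g v - v) = 0"
    using inv_norm_le_displacement[OF assms(1), of v] assms(2) inv_norm_nonneg[of "\<rho> g v - v"] by simp
  then show "\<rho> g v = id v" using inv_norm_eq_0D[of "\<rho> g v - v"] by simp
qed

text \<open>\<open>\<rho> z\<close> is an isometry, so the displacement of \<open>v\<close> under
  the conjugate is that of \<open>\<rho> (inv z) v\<close> under \<open>g\<close>.\<close>

lemma displacement_conj_le:
  assumes g: "g \<in> carrier G" and z: "z \<in> carrier G"
  shows "displacement (z \<otimes> g \<otimes> inv z) \<le> displacement g"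
proof (rule displacement_leI)
  fix v assume v: "inv_norm v = 1"
  define w where "w = \<rho> (inv z) v"
  have "\<rho> (z \<otimes> g \<otimes> inv z) v - v = \<rho> z (\<rho> g w - w)"
    using g z by (simp add: w_def rep_mult rep_diff rep_inv)
  then have "inv_norm (\<rho> (z \<otimes> g \<otimes> inv z) v - v) = inv_norm (\<rho> g w - w)"
    using z by (simp add: inv_norm_rep)
  also have "\<dots> \<le> displacement g * inv_norm w" using g by (rule inv_norm_le_displacement)
  finally show "inv_norm (\<rho> (z \<otimes> g \<otimes> inv z) v - v) \<le> displacement g"
    using z v by (simp add: w_def inv_norm_rep)
qed

text \<open>
  With \<open>g = 1 + a\<close> and \<open>h = 1 + b\<close> in the endomorphism ring, \<open>g h - h g = a b - b a\<close>.
\<close>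

lemma displacement_commutator_le:
  assumes g: "g \<in> carrier G" and h: "h \<in> carrier G"
  shows "displacement (g \<otimes> h \<otimes> inv (h \<otimes> g)) \<le> 2 * displacement g * displacement h"
proof (rule displacement_leI)
  fix v assume v: "inv_norm v = 1"
  \<comment> \<open>In terms of \<open>w\<close>, which is again a unit vector, the displacement of
    \<open>v\<close> under the commutator is \<open>g h - h g\<close> applied to
    \<open>w\<close>.\<close>
  define w where "w = \<rho> (inv (h \<otimes> g)) v"
  have w: "inv_norm w = 1" using g h v by (simp add: w_def inv_norm_rep)
  have v_eq: "v = \<rho> h (\<rho> g w)"
    using g h rep_inv(2)[of "h \<otimes> g" v] by (simp add: w_def rep_mult)
  have "\<rho> (g \<otimes> h \<otimes> inv (h \<otimes> g)) v = \<rho> g (\<rho> h w)"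
    using g h unfolding w_def by (subst rep_mult) (simp_all add: rep_mult)
  then have "\<rho> (g \<otimes> h \<otimes> inv (h \<otimes> g)) v - v
      = (\<rho> g (\<rho> h w - w) - (\<rho> h w - w)) - (\<rho> h (\<rho> g w - w) - (\<rho> g w - w))"
    using g h by (simp add: v_eq rep_diff)
  also have "inv_norm \<dots> \<le> inv_norm (\<rho> g (\<rho> h w - w) - (\<rho> h w - w))
      + inv_norm (\<rho> h (\<rho> g w - w) - (\<rho> g w - w))"
    by (rule inv_norm_diff)
  also have "\<dots> \<le> displacement g * inv_norm (\<rho> h w - w) + displacement h * inv_norm (\<rho> g w - w)"
    using g h by (intro add_mono inv_norm_le_displacement)
  also have "\<dots> \<le> displacement g * displacement h + displacement h * displacement g"
    using g h w inv_norm_le_displacement[of g w] inv_norm_le_displacement[of h w]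
    by (intro add_mono mult_left_mono displacement_nonneg) auto
  finally show "inv_norm (\<rho> (g \<otimes> h \<otimes> inv (h \<otimes> g)) v - v) \<le> 2 * displacement g * displacement h"
    by simp
qed

text \<open>By invariance, \<open>\<rho> g\<close> and \<open>\<rho> h\<close> are as far apart as
  \<open>\<rho> (inv h \<otimes> g)\<close> and the identity. Evaluating the operators on finitely
  many unit vectors and functionals that witness this turns the group into a separated subset of a
  unit ball, spanned by \<open>(dim UNIV)\<^sup>2\<close> complex vectors.\<close>

lemma order_le_of_displacement:
  assumes r: "0 < r" "r < 1" "2 * r / (1 - r) < \<delta>"
    and far: "\<And>g. g \<in> carrier G \<Longrightarrow> g \<noteq> \<one> \<Longrightarrow> \<delta> < displacement g"
  shows "real (order G) \<le> (1 / r) ^ (2 * (dim UNIV)\<^sup>2)"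
proof -
  \<comment> \<open>One coordinate for each ordered pair of distinct elements: it only has to
    separate that pair, so finitely many test vectors replace the whole unit sphere.\<close>
  define J where "J = {(g, h). g \<in> carrier G \<and> h \<in> carrier G \<and> g \<noteq> h}"
  define P where "P j v k b \<longleftrightarrow> inv_norm v = 1 \<and> k \<in> carrier G \<and> b \<in> B
      \<and> \<delta> \<le> cmod (matrix_coeff k b (\<rho> (fst j) v) - matrix_coeff k b (\<rho> (snd j) v))" for j v k b
  have "\<exists>v k b. P j v k b" if "j \<in> J" for j
  proof -
    obtain g h where j: "j = (g, h)" by (cases j)
    then have g: "g \<in> carrier G" and h: "h \<in> carrier G" and "g \<noteq> h"
      using that by (simp_all add: J_def)
    then have "inv h \<otimes> g \<noteq> \<one>"
      by (metis inv_closed inv_equality inv_inv)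
    then have "\<not> displacement (inv h \<otimes> g) \<le> \<delta>"
      using far g h by (simp add: not_le)
    \<comment> \<open>The supremum need not be attained; the strict inequality in \<open>far\<close>
      is what yields an actual unit vector \<open>v\<close>.\<close>
    then obtain v where v: "inv_norm v = 1" "\<delta> < inv_norm (\<rho> (inv h \<otimes> g) v - v)"
      using displacement_leI[of "inv h \<otimes> g" \<delta>] by force
    have "\<rho> h (\<rho> (inv h \<otimes> g) v - v) = \<rho> g v - \<rho> h v"
      using g h by (simp add: rep_diff rep_mult rep_inv)
    then have "\<delta> < inv_norm (\<rho> g v - \<rho> h v)"
      using v(2) inv_norm_rep[OF h] by metis
    moreover obtain k b where "k \<in> carrier G" "b \<in> B"
        "inv_norm (\<rho> g v - \<rho> h v) = cmod (matrix_coeff k b (\<rho> g v - \<rho> h v))"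
      by (rule inv_norm_attained)
    ultimately have "P j v k b"
      using v(1) g h by (simp add: P_def j matrix_coeff_diff)
    then show ?thesis by blast
  qed
  then obtain v k b where "\<And>j. j \<in> J \<Longrightarrow> P j (v j) (k j) (b j)"
    by metis
  then have wit: "inv_norm (v j) = 1" "k j \<in> carrier G" "b j \<in> B"
      "\<delta> \<le> cmod (matrix_coeff (k j) (b j) (\<rho> (fst j) (v j)) - matrix_coeff (k j) (b j) (\<rho> (snd j) (v j)))"
    if "j \<in> J" for j
    using that by (auto simp: P_def)
  define y where "y g j = matrix_coeff (k j) (b j) (\<rho> g (v j))" for g j
  have "real (card (carrier G)) \<le> (1 / r) ^ (2 * card (B \<times> B))"
  proof (rule card_separated_le_complex[OF r])
    have "J \<subseteq> carrier G \<times> carrier G" by (auto simp: J_def)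
    then show "finite J" using finite_carrier by (meson finite_SigmaI finite_subset)
    show "finite (B \<times> B)" using finite_Basis by simp
    show "y g j = (\<Sum>i\<in>B \<times> B. matrix_coeff g (snd i) (fst i)
        * (representation B (v j) (fst i) * matrix_coeff (k j) (b j) (snd i)))"
      if "g \<in> carrier G" "j \<in> J" for g j
      using matrix_coeff_rep[of g "k j" "b j" "v j"] that wit[of j]
      by (simp add: y_def case_prod_unfold)
    show "cmod (y g j) \<le> 1" if "g \<in> carrier G" "j \<in> J" for g j
      using norm_matrix_coeff_le[of "k j" "b j" "\<rho> g (v j)"] that wit[of j]
      by (simp add: y_def inv_norm_rep)
    show "\<exists>j\<in>J. \<delta> \<le> cmod (y g j - y h j)" if "g \<in> carrier G" "h \<in> carrier G" "g \<noteq> h" for g h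
      using wit[of "(g, h)"] that by (intro bexI[of _ "(g, h)"]) (auto simp: y_def J_def)
  qed (rule finite_carrier)
  then show ?thesis
    by (simp add: order_def card_cartesian_product power2_eq_square)
qed

lemma displacement_ge_half:
  assumes "simple_group G" and "\<not> cyclic_group G"
    and faithful: "\<And>g. g \<in> carrier G \<Longrightarrow> \<rho> g = id \<Longrightarrow> g = \<one>"
    and "g \<in> carrier G" "g \<noteq> \<one>"
  shows "1 / 2 \<le> displacement g"
proof -
  interpret simple_group G by fact
  define m where "m = arg_min_on displacement (carrier G - {\<one>})"
  have fin: "finite (carrier G - {\<one>})" and ne: "carrier G - {\<one>} \<noteq> {}"
    using finite_carrier assms(4,5) by auto
  have "m \<in> carrier G - {\<one>}"
    unfolding m_def by (rule arg_min_if_finite(1)[OF fin ne])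
  then have m: "m \<in> carrier G" "m \<noteq> \<one>" by auto
  have min: "displacement m \<le> displacement h" if "h \<in> carrier G" "h \<noteq> \<one>" for h
    unfolding m_def using that by (intro arg_min_least[OF fin ne]) auto
  have "1 / 2 \<le> displacement m"
  proof (rule ccontr)
    assume small: "\<not> 1 / 2 \<le> displacement m"
    \<comment> \<open>Faithfulness excludes displacement 0. Positivity is needed to conclude
      \<open>2 * displacement m * displacement m < displacement m\<close> from
      \<open>displacement m < 1 / 2\<close>.\<close>
    have pos: "0 < displacement m"
      using displacement_nonneg[OF m(1)] displacement_eq_0D[OF m(1)] faithful m by fastforce
    have "m \<otimes> (z \<otimes> m \<otimes> inv z) = z \<otimes> m \<otimes> inv z \<otimes> m" if z: "z \<in> carrier G" for z
    proof -
      define h where "h = z \<otimes> m \<otimes> inv z"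
      have h: "h \<in> carrier G" using z m by (simp add: h_def)
      have "displacement (m \<otimes> h \<otimes> inv (h \<otimes> m)) \<le> 2 * displacement m * displacement h"
        using m h by (intro displacement_commutator_le)
      also have "\<dots> \<le> 2 * displacement m * displacement m"
        unfolding h_def using pos z m by (intro mult_left_mono displacement_conj_le) auto
      also have "\<dots> < displacement m" using small pos by simp
      finally have "m \<otimes> h \<otimes> inv (h \<otimes> m) = \<one>"
        using min[of "m \<otimes> h \<otimes> inv (h \<otimes> m)"] m h by fastforce
      then have "m \<otimes> h = h \<otimes> m"
        using m h by (metis inv_closed inv_equality inv_inv m_closed)
      then show ?thesis by (simp add: h_def)
    qed
    then have "cyclic_group G"
      using commutes_with_conjugates_imp_cyclic[OF m] by blast
    then show False using assms(2) by contradiction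
  qed
  then show ?thesis using min[OF assms(4,5)] by linarith
qed

end

section \<open>From the order bound to the dimension bound\<close>

theorem theorem4p7:
  fixes G :: "('g, 'm) monoid_scheme" and n :: nat
    and scale :: "complex \<Rightarrow> 'v::ab_group_add \<Rightarrow> 'v" and \<rho> :: "'g \<Rightarrow> 'v \<Rightarrow> 'v"
  assumes "simple_group G" and "finite (carrier G)" and "\<not> cyclic_group G"
    and "order G = n"
    and "fd_representation G scale \<rho>" and "nontrivial_representation G \<rho>"
  shows "real (vector_space.dim scale UNIV) \<ge> sqrt (ln (real n)) / 2"
proof -
  interpret simple_group G by fact
  obtain B where B: "finite_dimensional_vector_space scale B" and rep: "\<rho> \<in> hom G (GL scale)"
    using assms(5) by (auto simp: fd_representation_def)
  interpret V: finite_dimensional_vector_space scale B by (rule B)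
  obtain g where g: "g \<in> carrier G" "\<rho> g \<noteq> id"
    using assms(6) by (auto simp: nontrivial_representation_def)
  \<comment> \<open>On the zero space every map is the identity, contrary to non-triviality.\<close>
  have "B \<noteq> {}"
  proof
    assume "B = {}"
    then have "UNIV = {0 :: 'v}" using V.span_Basis V.span_empty by simp
    then have "v = 0" for v :: 'v by (metis UNIV_I singletonD)
    then have "\<rho> g = id" by (metis eq_id_iff)
    then show False using g(2) by contradiction
  qed
  then interpret finite_group_representation scale B G \<rho>
    by unfold_locales (use rep assms(2) in auto)
  interpret hom: group_hom G "GL scale" \<rho>
    using rep group_GL[OF V.vector_space_axioms] by (intro group_hom.intro group_hom_axioms.intro is_group)
  \<comment> \<open>The kernel is normal and misses \<open>g\<close>, so simplicity makes the
    representation faithful.\<close>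
  have "kernel G (GL scale) \<rho> = {\<one>\<^bsub>G\<^esub>}"
    using no_real_normal_subgroup[OF hom.normal_kernel] g by (auto simp: kernel_def GL_def)
  then have "h = \<one>\<^bsub>G\<^esub>" if "h \<in> carrier G" "\<rho> h = id" for h
    using that by (auto simp: kernel_def GL_def)
  then have "1 / 2 \<le> displacement h" if "h \<in> carrier G" "h \<noteq> \<one>\<^bsub>G\<^esub>" for h
    using displacement_ge_half[OF assms(1,3)] that by blast
  \<comment> \<open>Any \<open>\<delta>\<close> strictly between 2/5 and 1/2 would do:
    \<open>r = 1 / 6\<close> gives \<open>2 * r / (1 - r) = 2 / 5\<close>, and 1/2 itself is not
    known to be exceeded.\<close>
  then have far: "9 / 20 < displacement h" if "h \<in> carrier G" "h \<noteq> \<one>\<^bsub>G\<^esub>" for h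
    using that by fastforce
  have "real n \<le> (1 / (1 / 6)) ^ (2 * (V.dim UNIV)\<^sup>2)"
    unfolding assms(4)[symmetric]
    by (rule order_le_of_displacement[of "1 / 6" "9 / 20", OF _ _ _ far]) simp_all
  also have "\<dots> = 36 ^ (V.dim UNIV)\<^sup>2" unfolding power_mult by simp
  also have "\<dots> \<le> exp 4 ^ (V.dim UNIV)\<^sup>2"
  proof (rule power_mono)
    \<comment> \<open>The bound \<open>1 + 1 + 1 / 2\<close> for \<open>exp 1\<close> suffices,
      since \<open>(5 / 2) ^ 4 = 625 / 16\<close> exceeds 36. The exponent 4 becomes the factor 2 of
      \<open>(2 * d)^2\<close>, for \<open>d\<close> the dimension, and hence the final division by
      2.\<close>
    have "(5 / 2 :: real) \<le> exp 1"
      using exp_lower_Taylor_quadratic[of 1] by simp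
    then have "(5 / 2 :: real) ^ 4 \<le> exp 1 ^ 4" by (intro power_mono) auto
    also have "exp 1 ^ 4 = exp (4 :: real)"
      using exp_of_nat_mult[of 4 "1 :: real"] by simp
    finally show "36 \<le> exp (4 :: real)" by (simp add: power_divide)
  qed simp
  also have "\<dots> = exp ((2 * real (V.dim UNIV))\<^sup>2)"
    using exp_of_nat_mult[of "(V.dim UNIV)\<^sup>2" "4 :: real"]
    by (simp add: power_mult_distrib mult.commute)
  finally have "real n \<le> exp ((2 * real (V.dim UNIV))\<^sup>2)" .
  moreover have "0 < real n" using order_gt_one assms(4) by simp
  ultimately have "ln (real n) \<le> (2 * real (V.dim UNIV))\<^sup>2"
    by (metis exp_le_cancel_iff exp_ln)
  then have "sqrt (ln (real n)) \<le> 2 * real (V.dim UNIV)"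
    by (intro real_le_lsqrt) auto
  then show ?thesis by simp
qed

end
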